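(* Let $F$ be a continuous cumulative distribution function on $(-\infty,\infty)$, let $\mu_1,\mu_2\in\mathbb{R}$ and $\sigma_1,\sigma_2>0$, and for $i=1,2$ let $X_i$ be a real random variable with cumulative distribution function $F_i(x)=F\left(\frac{x-\mu_i}{\sigma_i}\right)$. Then: 1. When $\sigma_1=\sigma_2$, $X_1\preceq X_2$ if and only if $\mu_1\le\mu_2$. 2. When $\sigma_1>\sigma_2$, $X_1\preceq_{\mathcal{A}}X_2$ and $X_2\preceq_{\overline{\mathcal{A}}}X_1$ for $\mathcal{A}=\{A\in\mathbb{R}: A\le \mathsf{A}\}$, where $\mathsf{A}=\mu_2+(\mu_1-\mu_2)/(1-\sigma_1/\sigma_2)$. 3. When $\sigma_1<\sigma_2$, $X_1\preceq_{\mathcal{A}}X_2$ and $X_2\preceq_{\overline{\mathcal{A}}}X_1$ for $\mathcal{A}=\{A\in\mathbb{R}: A\ge \mathsf{A}\}$, where $\mathsf{A}=\mu_2+(\mu_1-\mu_2)/(1-\sigma_1/\sigma_2)$.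
   Context: For real random variables $X_1,X_2$, write $X_1\preceq X_2$ ($X_1$ is stochastically less than $X_2$; first-order stochastic dominance of $X_1$ by $X_2$) if $P(X_1>A)\le P(X_2>A)$ for all $A\in(-\infty,\infty)$. For an interval $\mathcal{A}\subseteq\mathbb{R}$, write $X_1\preceq_{\mathcal{A}}X_2$ if $P(X_2>A)-P(X_1>A)\ge 0$ for all $A\in\mathcal{A}$. The complement of $\mathcal{A}$ in $\mathbb{R}$ is denoted $\overline{\mathcal{A}}$. The parameters $\mu_i$ and $\sigma_i>0$ are the location and scale parameters of a continuous location-scale family generated by $F$. *)

theory Defs
  imports "HOL-Probability.Probability"
begin

definition is_cdf :: "(real \<Rightarrow> real) \<Rightarrow> bool" where
  "is_cdf F \<longleftrightarrow> (\<exists>D. real_distribution D \<and> F = cdf D)"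

definition has_cdf :: "'a measure \<Rightarrow> ('a \<Rightarrow> real) \<Rightarrow> (real \<Rightarrow> real) \<Rightarrow> bool" where
  "has_cdf M X F \<longleftrightarrow> cdf (distr M borel X) = F"

text \<open>
  Stochastic dominance depends only on the laws of the two random variables, so they are
  not required to live on the same probability space; each comes with its own measure.
\<close>

definition stoch_le ::
    "'a measure \<Rightarrow> ('a \<Rightarrow> real) \<Rightarrow> 'b measure \<Rightarrow> ('b \<Rightarrow> real) \<Rightarrow> bool" where
  "stoch_le M X N Y \<longleftrightarrow>
     (\<forall>a::real. measure M {\<omega> \<in> space M. X \<omega> > a} \<le> measure N {\<omega> \<in> space N. Y \<omega> > a})"

definition stoch_le_on ::
    "real set \<Rightarrow> 'a measure \<Rightarrow> ('a \<Rightarrow> real) \<Rightarrow> 'b measure \<Rightarrow> ('b \<Rightarrow> real) \<Rightarrow> bool" where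
  "stoch_le_on I M X N Y \<longleftrightarrow>
     (\<forall>a\<in>I. measure N {\<omega> \<in> space N. Y \<omega> > a} - measure M {\<omega> \<in> space M. X \<omega> > a} \<ge> 0)"

end

theory Submission
  imports Defs
begin

text \<open>
  The survival function of \<open>X\<^sub>i\<close> at \<open>a\<close> is \<open>1 - F z\<^sub>i\<close>, where \<open>z\<^sub>i = (a - \<mu>\<^sub>i) / \<sigma>\<^sub>i\<close> is the
  standardised threshold. As \<open>F\<close> is monotone, comparing tails at \<open>a\<close> comes down to comparing
  \<open>z\<^sub>1\<close> with \<open>z\<^sub>2\<close> (lemma \<open>survival_le_if_standardised_le\<close>). Both are affine in \<open>a\<close>.

  For different scales the two lines cross exactly once, namely at the threshold \<open>c\<close> of the
  theorem, and \<open>z\<^sub>1 - z\<^sub>2\<close> is \<open>a - c\<close> times a factor with the sign of \<open>\<sigma>\<^sub>2 - \<sigma>\<^sub>1\<close>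
  (lemma \<open>standardised_diff\<close>). Hence dominance goes one way on each side of \<open>c\<close>.

  For equal scales the lines are parallel, so \<open>\<mu>\<^sub>1 \<le> \<mu>\<^sub>2\<close> gives dominance everywhere. Conversely,
  dominance with \<open>\<mu>\<^sub>1 > \<mu>\<^sub>2\<close> would mean that \<open>F\<close> does not increase under a fixed positive shift;
  iterating the shift contradicts the limits \<open>0\<close> and \<open>1\<close> of \<open>F\<close> (lemma \<open>cdf_increases_under_shift\<close>).
  No strict monotonicity of \<open>F\<close> is available, so the limits have to supply the contradiction.
\<close>

lemma is_cdf_mono:
  assumes "is_cdf F" and "x \<le> y"
  shows "F x \<le> F y"
proof -
  obtain D where "real_distribution D" and F: "F = cdf D"
    using assms(1) unfolding is_cdf_def by blast
  then interpret real_distribution D by simp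
  show ?thesis using assms(2) F cdf_nondecreasing by simp
qed

text \<open>
  If \<open>F\<close> failed to increase under the shift by \<open>d\<close> at every point, then \<open>F (x + n d) \<le> F x\<close> for
  all \<open>n\<close>, and letting \<open>n\<close> tend to infinity would give \<open>F x \<ge> 1\<close> for every \<open>x\<close>, which the limit
  \<open>0\<close> at minus infinity excludes.
\<close>

lemma cdf_increases_under_shift:
  assumes "is_cdf F" and "d > 0"
  obtains x where "F x < F (x + d)"
proof (rule ccontr)
  assume "\<not> thesis"
  with that have step: "F (x + d) \<le> F x" for x
    by (meson not_less)
  obtain D where "real_distribution D" and F: "F = cdf D"
    using assms(1) unfolding is_cdf_def by blast
  then interpret real_distribution D by simp
  have iter: "F (x + real n * d) \<le> F x" for x n
  proof (induction n)
    case (Suc n)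
    have "x + real (Suc n) * d = (x + real n * d) + d"
      by (simp add: algebra_simps)
    then have "F (x + real (Suc n) * d) \<le> F (x + real n * d)"
      using step[of "x + real n * d"] by (simp only:)
    then show ?case using Suc by (rule order_trans)
  qed simp
  have "1 \<le> F x" for x
  proof (rule LIMSEQ_le_const2)
    have "filterlim (\<lambda>n. x + real n * d) at_top sequentially"
      using assms(2)
      by (intro filterlim_tendsto_add_at_top[OF tendsto_const]
            filterlim_at_top_mult_tendsto_pos[OF tendsto_const] filterlim_real_sequentially)
    then show "(\<lambda>n. F (x + real n * d)) \<longlonglongrightarrow> 1"
      unfolding F by (rule filterlim_compose[OF cdf_lim_at_top_prob])
    show "\<exists>N. \<forall>n\<ge>N. F (x + real n * d) \<le> F x"
      using iter by blast
  qed
  moreover have "(F \<longlongrightarrow> 0) at_bot"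
    unfolding F by (rule cdf_lim_at_bot)
  ultimately have "(1::real) \<le> 0"
    by (intro tendsto_lowerbound[of F 0 at_bot 1]) auto
  then show False by simp
qed

lemma survival_eq_one_minus_cdf:
  assumes "prob_space M" and "X \<in> borel_measurable M" and "has_cdf M X G"
  shows "measure M {\<omega> \<in> space M. X \<omega> > a} = 1 - G a"
proof -
  interpret prob_space M by fact
  have "G a = measure M (X -` {..a} \<inter> space M)"
    using assms(2,3) unfolding has_cdf_def cdf_def by (auto simp: measure_distr)
  also have "X -` {..a} \<inter> space M = {\<omega> \<in> space M. X \<omega> \<le> a}"
    by auto
  finally have "G a = measure M {\<omega> \<in> space M. X \<omega> \<le> a}" .
  moreover have "{\<omega> \<in> space M. X \<omega> > a} = space M - {\<omega> \<in> space M. X \<omega> \<le> a}"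
    by auto
  moreover have "{\<omega> \<in> space M. X \<omega> \<le> a} \<in> events"
    using assms(2) by measurable
  ultimately show ?thesis by (simp add: prob_compl)
qed

lemma survival_le_if_standardised_le:
  assumes "is_cdf F"
    and "prob_space M" and "X \<in> borel_measurable M"
    and "has_cdf M X (\<lambda>x. F ((x - \<mu>) / \<sigma>))"
    and "prob_space N" and "Y \<in> borel_measurable N"
    and "has_cdf N Y (\<lambda>x. F ((x - \<nu>) / \<tau>))"
    and "(a - \<nu>) / \<tau> \<le> (a - \<mu>) / \<sigma>"
  shows "measure M {\<omega> \<in> space M. X \<omega> > a} \<le> measure N {\<omega> \<in> space N. Y \<omega> > a}"
  using is_cdf_mono[OF assms(1,8)]
  by (simp add: survival_eq_one_minus_cdf[OF assms(2,3,4)]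
      survival_eq_one_minus_cdf[OF assms(5,6,7)])

text \<open>
  The difference of the standardised thresholds is affine in \<open>a\<close> with slope
  \<open>1 / \<sigma>\<^sub>1 - 1 / \<sigma>\<^sub>2\<close>, so it is that slope times the distance of \<open>a\<close> from its unique zero.
\<close>

lemma standardised_diff:
  fixes a \<mu>\<^sub>1 \<mu>\<^sub>2 \<sigma>\<^sub>1 \<sigma>\<^sub>2 :: real
  assumes "\<sigma>\<^sub>1 \<noteq> 0" and "\<sigma>\<^sub>2 \<noteq> 0" and "\<sigma>\<^sub>1 \<noteq> \<sigma>\<^sub>2"
  shows "(a - \<mu>\<^sub>1) / \<sigma>\<^sub>1 - (a - \<mu>\<^sub>2) / \<sigma>\<^sub>2
    = (1 / \<sigma>\<^sub>1 - 1 / \<sigma>\<^sub>2) * (a - (\<mu>\<^sub>2 + (\<mu>\<^sub>1 - \<mu>\<^sub>2) / (1 - \<sigma>\<^sub>1 / \<sigma>\<^sub>2)))"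
proof -
  have slope: "1 / \<sigma>\<^sub>1 - 1 / \<sigma>\<^sub>2 = (1 - \<sigma>\<^sub>1 / \<sigma>\<^sub>2) / \<sigma>\<^sub>1"
    using assms by (simp add: field_simps)
  have "1 - \<sigma>\<^sub>1 / \<sigma>\<^sub>2 \<noteq> 0"
    using assms by (simp add: field_simps)
  then have "(1 / \<sigma>\<^sub>1 - 1 / \<sigma>\<^sub>2) * ((\<mu>\<^sub>1 - \<mu>\<^sub>2) / (1 - \<sigma>\<^sub>1 / \<sigma>\<^sub>2)) = (\<mu>\<^sub>1 - \<mu>\<^sub>2) / \<sigma>\<^sub>1"
    unfolding slope by simp
  then have "(1 / \<sigma>\<^sub>1 - 1 / \<sigma>\<^sub>2) * (a - (\<mu>\<^sub>2 + (\<mu>\<^sub>1 - \<mu>\<^sub>2) / (1 - \<sigma>\<^sub>1 / \<sigma>\<^sub>2)))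
      = (1 / \<sigma>\<^sub>1 - 1 / \<sigma>\<^sub>2) * (a - \<mu>\<^sub>2) - (\<mu>\<^sub>1 - \<mu>\<^sub>2) / \<sigma>\<^sub>1"
    by (simp only: diff_diff_eq[symmetric] right_diff_distrib)
  then show ?thesis
    by (simp add: diff_divide_distrib algebra_simps)
qed

theorem lemma2p1:
  fixes F :: "real \<Rightarrow> real"
    and \<mu>\<^sub>1 \<mu>\<^sub>2 \<sigma>\<^sub>1 \<sigma>\<^sub>2 :: real
    and M\<^sub>1 :: "'a measure" and X\<^sub>1 :: "'a \<Rightarrow> real"
    and M\<^sub>2 :: "'b measure" and X\<^sub>2 :: "'b \<Rightarrow> real"
  assumes "is_cdf F" and "continuous_on UNIV F"
    and "\<sigma>\<^sub>1 > 0" and "\<sigma>\<^sub>2 > 0"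
    and "prob_space M\<^sub>1" and "X\<^sub>1 \<in> borel_measurable M\<^sub>1"
    and "prob_space M\<^sub>2" and "X\<^sub>2 \<in> borel_measurable M\<^sub>2"
    and "has_cdf M\<^sub>1 X\<^sub>1 (\<lambda>x. F ((x - \<mu>\<^sub>1) / \<sigma>\<^sub>1))"
    and "has_cdf M\<^sub>2 X\<^sub>2 (\<lambda>x. F ((x - \<mu>\<^sub>2) / \<sigma>\<^sub>2))"
  shows "(\<sigma>\<^sub>1 = \<sigma>\<^sub>2 \<longrightarrow> (stoch_le M\<^sub>1 X\<^sub>1 M\<^sub>2 X\<^sub>2 \<longleftrightarrow> \<mu>\<^sub>1 \<le> \<mu>\<^sub>2))
    \<and> (\<sigma>\<^sub>1 > \<sigma>\<^sub>2 \<longrightarrow>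
        (let c = \<mu>\<^sub>2 + (\<mu>\<^sub>1 - \<mu>\<^sub>2) / (1 - \<sigma>\<^sub>1 / \<sigma>\<^sub>2); I = {a. a \<le> c}
         in stoch_le_on I M\<^sub>1 X\<^sub>1 M\<^sub>2 X\<^sub>2 \<and> stoch_le_on (- I) M\<^sub>2 X\<^sub>2 M\<^sub>1 X\<^sub>1))
    \<and> (\<sigma>\<^sub>1 < \<sigma>\<^sub>2 \<longrightarrow>
        (let c = \<mu>\<^sub>2 + (\<mu>\<^sub>1 - \<mu>\<^sub>2) / (1 - \<sigma>\<^sub>1 / \<sigma>\<^sub>2); I = {a. a \<ge> c}
         in stoch_le_on I M\<^sub>1 X\<^sub>1 M\<^sub>2 X\<^sub>2 \<and> stoch_le_on (- I) M\<^sub>2 X\<^sub>2 M\<^sub>1 X\<^sub>1))"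
proof -
  let ?c = "\<mu>\<^sub>2 + (\<mu>\<^sub>1 - \<mu>\<^sub>2) / (1 - \<sigma>\<^sub>1 / \<sigma>\<^sub>2)"
  note le12 = survival_le_if_standardised_le[OF assms(1,5,6,9,7,8,10)]
  note le21 = survival_le_if_standardised_le[OF assms(1,7,8,10,5,6,9)]
  have equal: "stoch_le M\<^sub>1 X\<^sub>1 M\<^sub>2 X\<^sub>2 \<longleftrightarrow> \<mu>\<^sub>1 \<le> \<mu>\<^sub>2" if eq: "\<sigma>\<^sub>1 = \<sigma>\<^sub>2"
  proof
    assume "\<mu>\<^sub>1 \<le> \<mu>\<^sub>2"
    then show "stoch_le M\<^sub>1 X\<^sub>1 M\<^sub>2 X\<^sub>2"
      unfolding stoch_le_def using assms(4) eq by (intro allI le12) (simp add: divide_right_mono)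
  next
    assume dom: "stoch_le M\<^sub>1 X\<^sub>1 M\<^sub>2 X\<^sub>2"
    show "\<mu>\<^sub>1 \<le> \<mu>\<^sub>2"
    proof (rule ccontr)
      assume "\<not> \<mu>\<^sub>1 \<le> \<mu>\<^sub>2"
      then have "(\<mu>\<^sub>1 - \<mu>\<^sub>2) / \<sigma>\<^sub>2 > 0"
        using assms(4) by simp
      then obtain x where x: "F x < F (x + (\<mu>\<^sub>1 - \<mu>\<^sub>2) / \<sigma>\<^sub>2)"
        using cdf_increases_under_shift[OF assms(1)] by blast
      let ?a = "\<mu>\<^sub>1 + \<sigma>\<^sub>2 * x"
      have "(?a - \<mu>\<^sub>1) / \<sigma>\<^sub>1 = x" and "(?a - \<mu>\<^sub>2) / \<sigma>\<^sub>2 = x + (\<mu>\<^sub>1 - \<mu>\<^sub>2) / \<sigma>\<^sub>2"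
        using assms(4) eq by (simp_all add: field_simps)
      moreover have "F ((?a - \<mu>\<^sub>2) / \<sigma>\<^sub>2) \<le> F ((?a - \<mu>\<^sub>1) / \<sigma>\<^sub>1)"
        using dom[unfolded stoch_le_def, rule_format, of ?a]
        unfolding survival_eq_one_minus_cdf[OF assms(5,6,9)]
          survival_eq_one_minus_cdf[OF assms(7,8,10)] by simp
      ultimately show False using x by simp
    qed
  qed
  have larger: "stoch_le_on {a. a \<le> ?c} M\<^sub>1 X\<^sub>1 M\<^sub>2 X\<^sub>2 \<and> stoch_le_on (- {a. a \<le> ?c}) M\<^sub>2 X\<^sub>2 M\<^sub>1 X\<^sub>1"
    if less: "\<sigma>\<^sub>1 > \<sigma>\<^sub>2"
  proof -
    have slope: "1 / \<sigma>\<^sub>1 - 1 / \<sigma>\<^sub>2 \<le> 0"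
      using assms(3,4) less by (simp add: field_simps)
    have "(a - \<mu>\<^sub>2) / \<sigma>\<^sub>2 \<le> (a - \<mu>\<^sub>1) / \<sigma>\<^sub>1" if "a \<le> ?c" for a
      using standardised_diff[of \<sigma>\<^sub>1 \<sigma>\<^sub>2 a \<mu>\<^sub>1 \<mu>\<^sub>2] assms(3,4) less
        mult_nonpos_nonpos[OF slope, of "a - ?c"] that by simp
    moreover have "(a - \<mu>\<^sub>1) / \<sigma>\<^sub>1 \<le> (a - \<mu>\<^sub>2) / \<sigma>\<^sub>2" if "\<not> a \<le> ?c" for a
      using standardised_diff[of \<sigma>\<^sub>1 \<sigma>\<^sub>2 a \<mu>\<^sub>1 \<mu>\<^sub>2] assms(3,4) less
        mult_nonpos_nonneg[OF slope, of "a - ?c"] that by simp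
    ultimately show ?thesis
      unfolding stoch_le_on_def using le12 le21 by simp
  qed
  have smaller: "stoch_le_on {a. a \<ge> ?c} M\<^sub>1 X\<^sub>1 M\<^sub>2 X\<^sub>2 \<and> stoch_le_on (- {a. a \<ge> ?c}) M\<^sub>2 X\<^sub>2 M\<^sub>1 X\<^sub>1"
    if less: "\<sigma>\<^sub>1 < \<sigma>\<^sub>2"
  proof -
    have slope: "1 / \<sigma>\<^sub>1 - 1 / \<sigma>\<^sub>2 \<ge> 0"
      using assms(3,4) less by (simp add: field_simps)
    have "(a - \<mu>\<^sub>2) / \<sigma>\<^sub>2 \<le> (a - \<mu>\<^sub>1) / \<sigma>\<^sub>1" if "a \<ge> ?c" for a
      using standardised_diff[of \<sigma>\<^sub>1 \<sigma>\<^sub>2 a \<mu>\<^sub>1 \<mu>\<^sub>2] assms(3,4) less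
        mult_nonneg_nonneg[OF slope, of "a - ?c"] that by simp
    moreover have "(a - \<mu>\<^sub>1) / \<sigma>\<^sub>1 \<le> (a - \<mu>\<^sub>2) / \<sigma>\<^sub>2" if "\<not> a \<ge> ?c" for a
      using standardised_diff[of \<sigma>\<^sub>1 \<sigma>\<^sub>2 a \<mu>\<^sub>1 \<mu>\<^sub>2] assms(3,4) less
        mult_nonneg_nonpos[OF slope, of "a - ?c"] that by simp
    ultimately show ?thesis
      unfolding stoch_le_on_def using le12 le21 by simp
  qed
  show ?thesis
    unfolding Let_def using equal larger smaller by blast
qed

end
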